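(* Let $G$ be a connected simple graph with vertex set $\{v_1,\dots,v_n\}$, let $\mathbb{K}$ be a field, and let $A=(a_{ij})$ be an $n\times n$ matrix over $\mathbb{K}$ with $a_{ij}=0$ whenever $i\neq j$ and $v_i,v_j$ are not adjacent in $G$. Let $\pi=\pi_1\pi_2\cdots\pi_n$ be a permutation of $v_1,\dots,v_n$ (the update schedule). Then the system map of the linear SDS $(G,A,\pi)$ satisfies $$(G,A,\pi)=(I-A_{\pi})^{-1}(A-A_{\pi}),$$ where $I$ is the $n\times n$ identity matrix and $A_\pi$ is the $n\times n$ matrix with $[A_\pi]_{ij}=a_{ij}$ if $v_i$ appears after $v_j$ in $\pi$, and $[A_\pi]_{ij}=0$ otherwise (in particular all diagonal entries of $A_\pi$ are $0$).
   Context: A linear sequential dynamical system (SDS) $(G,A,\pi)$ over $\mathbb{K}$: each vertex $v_i$ carries a state $x_i\in\mathbb{K}$, and its local function is $f_{v_i}: x_i\mapsto a_{i1}x_1+\cdots+a_{in}x_n$. The local function $f_{v_i}$ induces the map $F_{v_i}:\mathbb{K}^n\to\mathbb{K}^n$ replacing the $i$-th coordinate of $[x_1,\dots,x_n]^T$ by $f_{v_i}(x_i)$ and leaving the others unchanged; as a matrix, $F_{v_i}$ equals the identity matrix except that its $i$-th row is $(a_{i1},\dots,a_{in})$. For an update schedule $\pi=\pi_1\cdots\pi_n$, the system map is $(G,A,\pi)=F_{\pi_n}F_{\pi_{n-1}}\cdots F_{\pi_1}$ (vertices are updated sequentially in the order $\pi_1,\pi_2,\dots$). *)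

theory Defs
  imports "HOL-Analysis.Analysis" "Graph_Theory.Digraph_Component"
begin

definition local_function :: "'k::field ^ 'n ^ 'n \<Rightarrow> 'n \<Rightarrow> 'k ^ 'n \<Rightarrow> 'k" where
  "local_function A i x = (\<Sum>j\<in>UNIV. A $ i $ j * x $ j)"

definition vertex_update :: "'k::field ^ 'n ^ 'n \<Rightarrow> 'n \<Rightarrow> 'k ^ 'n \<Rightarrow> 'k ^ 'n" where
  "vertex_update A i x = (\<chi> k. if k = i then local_function A i x else x $ k)"

lemma vertex_update_eq_matrix:
  "vertex_update A i = (*v) (\<chi> k. if k = i then A $ i else mat 1 $ k)"
  by (auto simp: fun_eq_iff vec_eq_iff vertex_update_def local_function_def
      matrix_vector_mult_def mat_def if_distrib[of "\<lambda>a. a * _"] cong: if_cong)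

(* fold applies the head of the list first, so for the schedule [p1, ..., pn] the system map is
   the composite F_pn o ... o F_p1.  The graph only constrains the support of A, so it is not an
   argument here. *)
definition sds_map :: "'k::field ^ 'n ^ 'n \<Rightarrow> 'n list \<Rightarrow> 'k ^ 'n \<Rightarrow> 'k ^ 'n" where
  "sds_map A \<pi> = fold (vertex_update A) \<pi>"

definition appears_after :: "'n list \<Rightarrow> 'n \<Rightarrow> 'n \<Rightarrow> bool" where
  "appears_after \<pi> i j \<longleftrightarrow> (\<exists>k l. k < l \<and> l < length \<pi> \<and> \<pi> ! k = j \<and> \<pi> ! l = i)"

definition schedule_part :: "'k::field ^ 'n ^ 'n \<Rightarrow> 'n list \<Rightarrow> 'k ^ 'n ^ 'n" where
  "schedule_part A \<pi> = (\<chi> i j. if appears_after \<pi> i j then A $ i $ j else 0)"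

end

(* If y is the system map applied to x, then updating v_i uses the new states y_j of the vertices
   before v_i in the schedule and the old states x_j of all others.  Hence
   y = A_pi y + (A - A_pi) x.  Since A_pi is strictly triangular in the schedule order, I - A_pi has
   trivial kernel, and the equation can be solved for y. *)
theory Submission
  imports Defs
begin

lemma appears_after_set:
  "appears_after \<pi> i j \<Longrightarrow> i \<in> set \<pi> \<and> j \<in> set \<pi>"
  unfolding appears_after_def by (metis nth_mem order.strict_trans)

text \<open>Serves inductions that extend the schedule at its end: the new vertex comes after
  everything already scheduled and changes no other precedence.\<close>

lemma appears_after_snoc:
  "appears_after (\<pi> @ [p]) i j \<longleftrightarrow> appears_after \<pi> i j \<or> i = p \<and> j \<in> set \<pi>"
proof
  assume "appears_after (\<pi> @ [p]) i j"
  then obtain k l where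
    kl: "k < l" "l < Suc (length \<pi>)" "(\<pi> @ [p]) ! k = j" "(\<pi> @ [p]) ! l = i"
    by (auto simp: appears_after_def)
  show "appears_after \<pi> i j \<or> i = p \<and> j \<in> set \<pi>"
  proof (cases "l = length \<pi>")
    case True
    then show ?thesis using kl by (auto simp: nth_append)
  next
    case False
    then have "k < l \<and> l < length \<pi> \<and> \<pi> ! k = j \<and> \<pi> ! l = i"
      using kl by (auto simp: nth_append)
    then show ?thesis by (auto simp: appears_after_def)
  qed
next
  assume "appears_after \<pi> i j \<or> i = p \<and> j \<in> set \<pi>"
  then show "appears_after (\<pi> @ [p]) i j"
  proof
    assume "appears_after \<pi> i j"
    then obtain k l where "k < l" "l < length \<pi>" "\<pi> ! k = j" "\<pi> ! l = i"
      by (auto simp: appears_after_def)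
    then show ?thesis
      unfolding appears_after_def by (intro exI[of _ k] exI[of _ l]) (auto simp: nth_append)
  next
    assume "i = p \<and> j \<in> set \<pi>"
    then obtain k where "k < length \<pi>" "\<pi> ! k = j" "i = p"
      by (auto simp: in_set_conv_nth)
    then show ?thesis
      unfolding appears_after_def
      by (intro exI[of _ k] exI[of _ "length \<pi>"]) (auto simp: nth_append)
  qed
qed

text \<open>Distinctness means that each vertex is updated at most once, so the state it receives is
  final and is what later updates read. Partial schedules are allowed so that induction can peel off
  the last update, the outermost map of the composite.\<close>

lemma sds_map_nth:
  fixes A :: "'k::field ^ 'n::finite ^ 'n"
  assumes "distinct \<pi>"
  shows "sds_map A \<pi> x $ i =
    (if i \<in> set \<pi>
     then \<Sum>j\<in>UNIV. A $ i $ j * (if appears_after \<pi> i j then sds_map A \<pi> x $ j else x $ j)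
     else x $ i)"
  using assms
proof (induction \<pi> arbitrary: i rule: rev_induct)
  case Nil
  then show ?case by (simp add: sds_map_def)
next
  case (snoc p \<pi>)
  let ?y = "sds_map A \<pi> x" and ?z = "sds_map A (\<pi> @ [p]) x"
  have p: "p \<notin> set \<pi>" and IH: "?y $ i =
    (if i \<in> set \<pi> then \<Sum>j\<in>UNIV. A $ i $ j * (if appears_after \<pi> i j then ?y $ j else x $ j)
     else x $ i)" for i
    using snoc by auto
  have z: "?z $ j = (if j = p then \<Sum>j\<in>UNIV. A $ p $ j * ?y $ j else ?y $ j)" for j
    by (simp add: sds_map_def vertex_update_def local_function_def)
  show ?case
  proof (cases "i = p")
    case True
    \<comment> \<open>When \<open>p\<close> is updated, the vertices of \<pi> already carry their
      final states and all others, \<open>p\<close> included, still carry their initial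
      ones.\<close>
    have "?y $ j = (if appears_after (\<pi> @ [p]) p j then ?z $ j else x $ j)" for j
      using p IH[of j] z[of j] appears_after_set[of \<pi> p j] by (auto simp: appears_after_snoc)
    then show ?thesis using True z[of p] by simp
  next
    case False
    \<comment> \<open>A predecessor of \<open>i\<close> lies in \<pi>, hence differs from
      \<open>p\<close> and keeps its state when \<open>p\<close> is updated.\<close>
    have "(if appears_after (\<pi> @ [p]) i j then ?z $ j else x $ j) =
        (if appears_after \<pi> i j then ?y $ j else x $ j)" for j
      using False p z[of j] appears_after_set[of \<pi> i j] by (auto simp: appears_after_snoc)
    then show ?thesis using False z[of i] IH[of i] by simp
  qed
qed

lemma schedule_part_mult_nth:
  fixes A :: "'k::field ^ 'n::finite ^ 'n"
  shows "(schedule_part A \<pi> *v z) $ i =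
    (\<Sum>j\<in>UNIV. if appears_after \<pi> i j then A $ i $ j * z $ j else 0)"
  by (auto simp: matrix_vector_mult_def schedule_part_def intro!: sum.cong)

text \<open>Forward substitution along the schedule: each coordinate of \<open>z\<close> is a
  combination of coordinates at earlier positions, which vanish by strong induction.\<close>

lemma schedule_part_fixed_point_eq_0:
  fixes A :: "'k::field ^ 'n::finite ^ 'n"
  assumes "distinct \<pi>" and z: "z = schedule_part A \<pi> *v z"
  shows "z = 0"
proof -
  have nth: "z $ (\<pi> ! l) = 0" if "l < length \<pi>" for l
    using that
  proof (induction l rule: less_induct)
    case (less l)
    have "z $ j = 0" if after: "appears_after \<pi> (\<pi> ! l) j" for j
    proof -
      obtain k m where "k < m" "m < length \<pi>" "\<pi> ! k = j" "\<pi> ! m = \<pi> ! l"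
        using after by (auto simp: appears_after_def)
      \<comment> \<open>Since a vertex occupies only one position, \<open>j\<close> sits at a
        position \<open>k < l\<close>, within reach of the induction hypothesis.\<close>
      moreover have "m = l"
        using calculation less.prems \<open>distinct \<pi>\<close> by (simp add: nth_eq_iff_index_eq)
      ultimately show ?thesis using less by auto
    qed
    then have "(schedule_part A \<pi> *v z) $ (\<pi> ! l) = 0"
      unfolding schedule_part_mult_nth by (intro sum.neutral) simp
    then show ?case using z by simp
  qed
  have "z $ i = 0" for i
  proof (cases "i \<in> set \<pi>")
    case True
    then show ?thesis using nth by (auto simp: in_set_conv_nth)
  next
    \<comment> \<open>An unscheduled vertex has a zero row in
      \<open>schedule_part A \<pi>\<close>.\<close>
    case False
    then have "(schedule_part A \<pi> *v z) $ i = 0"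
      unfolding schedule_part_mult_nth by (intro sum.neutral) (auto dest: appears_after_set)
    then show ?thesis using z by simp
  qed
  then show ?thesis by (simp add: vec_eq_iff)
qed

text \<open>A kernel vector is a fixed point of \<open>schedule_part A \<pi>\<close>, hence zero;
  for a square matrix a trivial kernel suffices.\<close>

lemma invertible_mat_1_minus_schedule_part:
  fixes A :: "'k::field ^ 'n::finite ^ 'n"
  assumes "distinct \<pi>"
  shows "invertible (mat 1 - schedule_part A \<pi>)"
  unfolding invertible_left_inverse matrix_left_invertible_ker
  using schedule_part_fixed_point_eq_0[OF assms]
  by (auto simp: matrix_vector_mult_diff_rdistrib)

lemma sds_map_implicit:
  fixes A :: "'k::field ^ 'n::finite ^ 'n"
  assumes "distinct \<pi>" and "set \<pi> = UNIV"
  shows "(mat 1 - schedule_part A \<pi>) *v sds_map A \<pi> x = (A - schedule_part A \<pi>) *v x"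
proof -
  let ?y = "sds_map A \<pi> x"
  have "?y $ i = (schedule_part A \<pi> *v ?y) $ i + ((A - schedule_part A \<pi>) *v x) $ i" for i
  proof -
    have "?y $ i = (\<Sum>j\<in>UNIV. A $ i $ j * (if appears_after \<pi> i j then ?y $ j else x $ j))"
      using assms by (subst sds_map_nth) auto
    \<comment> \<open>Each coefficient of row \<open>i\<close> belongs to exactly one of the two
      matrices: the first collects those that meet new states, the second those that meet old
      ones.\<close>
    also have "\<dots> = (\<Sum>j\<in>UNIV. schedule_part A \<pi> $ i $ j * ?y $ j
        + (A - schedule_part A \<pi>) $ i $ j * x $ j)"
      by (intro sum.cong) (auto simp: schedule_part_def)
    finally show ?thesis
      by (simp add: matrix_vector_mult_def sum.distrib)
  qed
  then show ?thesis
    by (simp add: vec_eq_iff matrix_vector_mult_diff_rdistrib)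
qed

text \<open>\<open>matrix_inv\<close> is a Hilbert choice, so its defining property has to be drawn
  from the existence of an inverse.\<close>

lemma matrix_inv_mult_left:
  assumes "invertible M"
  shows "matrix_inv M ** M = mat 1"
  using assms unfolding invertible_def matrix_inv_def by (rule someI2_ex) simp

theorem theorem1:
  fixes G :: "('n::finite, 'e) pre_digraph"
    and A :: "'k::field ^ 'n ^ 'n"
    and \<pi> :: "'n list"
  assumes "Digraph.graph G"
    and "verts G = UNIV"
    and "Digraph_Component.connected G"
    and "\<And>i j. i \<noteq> j \<Longrightarrow> \<not> i \<rightarrow>\<^bsub>G\<^esub> j \<Longrightarrow> A $ i $ j = 0"
    and "distinct \<pi>"
    and "set \<pi> = verts G"
  shows "invertible (mat 1 - schedule_part A \<pi>) \<and>
    sds_map A \<pi> = (*v) (matrix_inv (mat 1 - schedule_part A \<pi>) ** (A - schedule_part A \<pi>))"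
proof
  let ?M = "mat 1 - schedule_part A \<pi>"
  show inv: "invertible ?M"
    using assms(5) by (rule invertible_mat_1_minus_schedule_part)
  show "sds_map A \<pi> = (*v) (matrix_inv ?M ** (A - schedule_part A \<pi>))"
  proof
    fix x
    have "sds_map A \<pi> x = (matrix_inv ?M ** ?M) *v sds_map A \<pi> x"
      using inv by (simp add: matrix_inv_mult_left)
    also have "\<dots> = matrix_inv ?M *v ((A - schedule_part A \<pi>) *v x)"
      using assms by (simp add: sds_map_implicit flip: matrix_vector_mul_assoc)
    finally show "sds_map A \<pi> x = (matrix_inv ?M ** (A - schedule_part A \<pi>)) *v x"
      by (simp add: matrix_vector_mul_assoc)
  qed
qed

end
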